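(* Let $(m,P)$ be any feasible point of the optimal inertia allocation problem stated in the context. Then its objective value $\|\mathscr{G}\|_2^2=\operatorname{Trace}(B^{\mathsf T}PB)$ satisfies $$\frac{\underline{v}}{2\overline{d}}\left(\operatorname{Trace}(NL^{\dagger})+\sum_{i=1}^n\frac{s_i}{m_i}\right)\;\le\;\|\mathscr{G}\|_2^2\;\le\;\frac{\overline{v}}{2\underline{d}}\left(\operatorname{Trace}(NL^{\dagger})+\sum_{i=1}^n\frac{s_i}{m_i}\right),$$ where $\underline{v}=\min_i v_i$, $\overline{v}=\max_i v_i$, $\underline{d}=\min_i d_i$, $\overline{d}=\max_i d_i$, and $L^{\dagger}$ is the Moore-Penrose pseudo-inverse of $L$.
   Context: Setting. Let $n\ge 1$. The power network has nodes $\{1,\dots,n\}$ and symmetric susceptances $b_{ij}=b_{ji}\ge 0$ ($i\ne j$); $L\in\mathbb{R}^{n\times n}$ is the corresponding weighted graph Laplacian, with off-diagonal entries $-b_{ij}$ and diagonal entries $\sum_{j\ne i}b_{ij}$. The network graph (edges $\{i,j\}$ with $b_{ij}>0$) is connected. The nodes have inertia coefficients $m_i>0$ and damping coefficients $d_i>0$, and $M=\operatorname{diag}\{m_i\}$, $D=\operatorname{diag}\{d_i\}$. Disturbance strengths are $v_i\ge 0$, and $V=\operatorname{diag}\{v_i\}$. Penalties: $S=\operatorname{diag}\{s_i\}$ with $s_i>0$, and $N$ is the Laplacian matrix of a connected weighted graph on $\{1,\dots,n\}$ with weights $a_{ij}=a_{ji}\ge 0$ (not necessarily the same graph as the power network).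 The linear system $\mathscr{G}=(A,B,C)$ has state $(\theta,\omega)\in\mathbb{R}^{2n}$, input $\eta$ and output $y$, with $$A=\begin{bmatrix}0&I\\ -M^{-1}L&-M^{-1}D\end{bmatrix},\quad B=\begin{bmatrix}0\\ M^{-1}V^{1/2}\end{bmatrix},\quad C=\begin{bmatrix}N^{1/2}&0\\ 0&S^{1/2}\end{bmatrix}.$$ Its squared $\mathscr{H}_2$ norm is $\|\mathscr{G}\|_2^2=\int_0^\infty \operatorname{Trace}\big(B^{\mathsf T}e^{A^{\mathsf T}t}C^{\mathsf T}Ce^{At}B\big)\,dt$. Let $z_0\in\mathbb{R}^{2n}$ be the vector whose first $n$ entries are $1$ and whose last $n$ entries are $0$. Optimal inertia allocation problem: given bounds $0<\underline{m_i}\le\overline{m_i}$ and a budget $m_{\mathrm{bdg}}$, minimize over $m\in\mathbb{R}^n$ and $P\in\mathbb{R}^{2n\times 2n}$ the objective $\|\mathscr{G}\|_2^2=\operatorname{Trace}(B^{\mathsf T}PB)$ subject to $\sum_{i}m_i\le m_{\mathrm{bdg}}$, $m_i\in[\underline{m_i},\overline{m_i}]$ for all $i$, $PA+A^{\mathsf T}P+C^{\mathsf T}C=0$ and $Pz_0=0$ (where $A,B$ depend on $m$). *)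

theory Defs
  imports "HOL-Analysis.Analysis"
begin

text \<open>
  Nodes are the elements of a finite type, written 'n; the state space of the power system is then
  indexed by 'n + 'n, with Inl for the angles and Inr for the frequencies.  A matrix of type
  real^'c^'r has rows indexed by 'r and columns indexed by 'c.
\<close>

subsection \<open>Matrices\<close>

definition diag_mat :: "real^'n \<Rightarrow> real^'n^'n" where
  "diag_mat x = (\<chi> i j. if i = j then x $ i else 0)"

definition block_mat ::
  "real^'c^'r \<Rightarrow> real^'d^'r \<Rightarrow> real^'c^'q \<Rightarrow> real^'d^'q \<Rightarrow> real^('c + 'd)^('r + 'q)" where
  "block_mat W X Y Z = (\<chi> i j.
     case i of
       Inl i \<Rightarrow> (case j of Inl j \<Rightarrow> W $ i $ j | Inr j \<Rightarrow> X $ i $ j)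
     | Inr i \<Rightarrow> (case j of Inl j \<Rightarrow> Y $ i $ j | Inr j \<Rightarrow> Z $ i $ j))"

definition block_col :: "real^'c^'r \<Rightarrow> real^'c^'q \<Rightarrow> real^'c^('r + 'q)" where
  "block_col X Y = (\<chi> i j. case i of Inl i \<Rightarrow> X $ i $ j | Inr i \<Rightarrow> Y $ i $ j)"

definition psd :: "real^'n^'n \<Rightarrow> bool" where
  "psd X \<longleftrightarrow> transpose X = X \<and> (\<forall>x. 0 \<le> x \<bullet> (X *v x))"

text \<open>Meaningful for positive semidefinite \<^term>\<open>X\<close>, where such a root exists and is unique.\<close>

definition mat_sqrt :: "real^'n^'n \<Rightarrow> real^'n^'n" where
  "mat_sqrt X = (THE R. psd R \<and> R ** R = X)"

text \<open>The unique matrix satisfying the four Penrose equations.\<close>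

definition pinv :: "real^'n^'m \<Rightarrow> real^'m^'n" where
  "pinv X = (THE Y. X ** Y ** X = X \<and> Y ** X ** Y = Y \<and>
                    transpose (X ** Y) = X ** Y \<and> transpose (Y ** X) = Y ** X)"

text \<open>
  The library function \<^const>\<open>exp\<close> is not available here, since multiplication and powers on
  the vector type are not the matrix ones.
\<close>

primrec mat_pow :: "real^'n^'n \<Rightarrow> nat \<Rightarrow> real^'n^'n" where
  "mat_pow X 0 = mat 1"
| "mat_pow X (Suc k) = X ** mat_pow X k"

definition mat_exp :: "real^'n^'n \<Rightarrow> real^'n^'n" where
  "mat_exp X = (\<Sum>k. mat_pow X k /\<^sub>R fact k)"

subsection \<open>Weighted graphs\<close>

text \<open>Weights on the diagonal are irrelevant to all of the following notions.\<close>

definition graph_weights :: "('n \<Rightarrow> 'n \<Rightarrow> real) \<Rightarrow> bool" where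
  "graph_weights w \<longleftrightarrow> (\<forall>i j. i \<noteq> j \<longrightarrow> w i j = w j i \<and> 0 \<le> w i j)"

definition graph_connected :: "('n \<Rightarrow> 'n \<Rightarrow> real) \<Rightarrow> bool" where
  "graph_connected w \<longleftrightarrow> (\<forall>i j. (i, j) \<in> {(k, l). k \<noteq> l \<and> 0 < w k l}\<^sup>*)"

definition laplacian :: "('n::finite \<Rightarrow> 'n \<Rightarrow> real) \<Rightarrow> real^'n^'n" where
  "laplacian w = (\<chi> i j. if i = j then (\<Sum>k\<in>UNIV - {i}. w i k) else - w i j)"

subsection \<open>The power system and its squared H2 norm\<close>

definition sysA :: "real^'n^'n \<Rightarrow> real^'n \<Rightarrow> real^'n \<Rightarrow> real^('n + 'n)^('n + 'n)" where
  "sysA L d m =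
     block_mat 0 (mat 1)
       (- (matrix_inv (diag_mat m) ** L)) (- (matrix_inv (diag_mat m) ** diag_mat d))"

definition sysB :: "real^'n \<Rightarrow> real^'n \<Rightarrow> real^'n^('n + 'n)" where
  "sysB v m = block_col 0 (matrix_inv (diag_mat m) ** mat_sqrt (diag_mat v))"

definition sysC :: "real^'n^'n \<Rightarrow> real^'n \<Rightarrow> real^('n + 'n)^('n + 'n)" where
  "sysC N s = block_mat (mat_sqrt N) 0 0 (mat_sqrt (diag_mat s))"

definition h2_integrand ::
  "real^'k^'k \<Rightarrow> real^'p^'k \<Rightarrow> real^'k^'q \<Rightarrow> real \<Rightarrow> real" where
  "h2_integrand A B C t =
     trace (transpose B ** mat_exp (t *\<^sub>R transpose A) ** transpose C ** C ** mat_exp (t *\<^sub>R A) ** B)"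

definition h2_norm_sq :: "real^'k^'k \<Rightarrow> real^'p^'k \<Rightarrow> real^'k^'q \<Rightarrow> real" where
  "h2_norm_sq A B C = integral {0..} (h2_integrand A B C)"

subsection \<open>The optimal inertia allocation problem\<close>

definition z0 :: "real^('n::finite + 'n)" where
  "z0 = (\<chi> i. case i of Inl _ \<Rightarrow> 1 | Inr _ \<Rightarrow> 0)"

definition inertia_feasible ::
  "real^'n^'n \<Rightarrow> real^'n \<Rightarrow> real^'n^'n \<Rightarrow> real^'n \<Rightarrow> real^'n \<Rightarrow> real^'n \<Rightarrow> real
    \<Rightarrow> real^'n \<Rightarrow> real^('n + 'n)^('n + 'n) \<Rightarrow> bool" where
  "inertia_feasible L d N s mlo mhi mbdg m P \<longleftrightarrow>
     (\<Sum>i\<in>UNIV. m $ i) \<le> mbdg \<and>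
     (\<forall>i. mlo $ i \<le> m $ i \<and> m $ i \<le> mhi $ i) \<and>
     P ** sysA L d m + transpose (sysA L d m) ** P + transpose (sysC N s) ** sysC N s = 0 \<and>
     P *v z0 = 0"

definition inertia_objective :: "real^'n \<Rightarrow> real^'n \<Rightarrow> real^('n + 'n)^('n + 'n) \<Rightarrow> real" where
  "inertia_objective v m P = trace (transpose (sysB v m) ** P ** sysB v m)"

end

(*
  All trajectories of the system converge to multiples of z0: the linear functional with coefficients
  (d, m) is conserved, and on its kernel the energy, perturbed by a small cross term, is a strict
  Lyapunov function.  Since P z0 = 0, the Lyapunov equation integrates along trajectories to the
  identity between the H2 norm and Trace(B^T P B); it also shows that the quadratic form of P is
  nonnegative, whence z0^T P = 0 although P is not assumed to be symmetric.

  Write P = [W X; Y Z].  The diagonal of the (2,2) block of the Lyapunov equation expresses Z_ii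
  through X_ii + Y_ii + s_i, while multiplying its (1,1) block N = X M^-1 L + L M^-1 Y by the
  pseudo-inverse of L and taking traces gives Trace(N L^+) = sum_i (X_ii + Y_ii) / m_i.  Hence the
  objective is the sum of v_i / (2 d_i) times nonnegative numbers whose total is
  Trace(N L^+) + sum_i s_i / m_i.
*)

theory Submission
  imports Defs
begin

subsection \<open>Symmetric matrices, square roots and pseudo-inverses\<close>

lemma psd_form_zero:
  fixes f :: "real^'n \<Rightarrow> real^'n"
  assumes "linear f" "subspace S" and nonneg: "\<And>x. x \<in> S \<Longrightarrow> 0 \<le> x \<bullet> f x"
    and "u \<in> S" "u \<bullet> f u = 0" "y \<in> S"
  shows "y \<bullet> f u + u \<bullet> f y = 0"
proof -
  interpret linear f by fact
  define q where "q = y \<bullet> f u + u \<bullet> f y"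
  have q: "0 \<le> y \<bullet> f y + t * q" for t
  proof (cases "t = 0")
    case True then show ?thesis using nonneg[OF \<open>y \<in> S\<close>] by simp
  next
    case False
    have "0 \<le> (y + t *\<^sub>R u) \<bullet> f (y + t *\<^sub>R u)"
      using assms by (intro nonneg) (auto intro: subspace_add subspace_scale)
    then show ?thesis
      using assms(5) by (simp add: q_def add scale inner_add_left inner_add_right algebra_simps)
  qed
  have "q = 0"
  proof (rule ccontr)
    assume "q \<noteq> 0"
    then show False using q[of "- (y \<bullet> f y + 1) / q"] by simp
  qed
  then show ?thesis by (simp add: q_def)
qed

lemma symmetric_inner_commute:
  fixes X :: "real^'n^'n"
  assumes "transpose X = X"
  shows "(X *v x) \<bullet> y = x \<bullet> (X *v y)"
proof -
  have "X *v x = x v* X" by (subst assms[symmetric]) (rule transpose_matrix_vector)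
  then show ?thesis by (simp only: dot_lmul_matrix)
qed

lemma symmetric_eigenvector_in_subspace:
  fixes X :: "real^'n^'n"
  assumes sym: "transpose X = X" and S: "subspace S" "S \<noteq> {0}"
    and inv: "\<And>x. x \<in> S \<Longrightarrow> X *v x \<in> S"
  obtains u l where "u \<in> S" "norm u = 1" "X *v u = l *\<^sub>R u"
proof -
  let ?K = "S \<inter> sphere 0 1"
  obtain x where "x \<in> S" "x \<noteq> 0" using S subspace_0 by blast
  then have "x /\<^sub>R norm x \<in> ?K" using S by (simp add: subspace_scale)
  moreover have "compact ?K"
    using closed_subspace[OF S(1)] compact_sphere by (simp add: closed_Int_compact)
  moreover have "continuous_on ?K (\<lambda>x. x \<bullet> (X *v x))"
    by (intro continuous_intros)
  ultimately obtain u where u: "u \<in> ?K" and max: "\<And>y. y \<in> ?K \<Longrightarrow> y \<bullet> (X *v y) \<le> u \<bullet> (X *v u)"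
    using continuous_attains_sup[of ?K "\<lambda>x. x \<bullet> (X *v x)"] by blast
  define l where "l = u \<bullet> (X *v u)"
  define f where "f y = l *\<^sub>R y - X *v y" for y
  have lin: "linear f"
    unfolding f_def by (intro linear_compose_sub linear_compose_scale_right matrix_vector_mul_linear linear_ident)
  have nonneg: "0 \<le> y \<bullet> f y" if "y \<in> S" for y
  proof (cases "y = 0")
    case False
    then have "y /\<^sub>R norm y \<in> ?K" using that S by (simp add: subspace_scale)
    from max[OF this] have "(y \<bullet> (X *v y)) / (norm y)^2 \<le> l"
      by (simp add: l_def matrix_vector_mult_scaleR power2_eq_square divide_simps)
    then show ?thesis
      using False by (simp add: f_def inner_diff_right field_simps power2_norm_eq_inner)
  qed simp
  have "u \<bullet> f u = 0"
    using u by (simp add: f_def l_def inner_diff_right) (simp add: norm_eq_1)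
  moreover have fu: "f u \<in> S"
    using u S inv by (simp add: f_def subspace_diff subspace_scale)
  ultimately have "f u \<bullet> f u + u \<bullet> f (f u) = 0"
    using psd_form_zero[OF lin S(1) nonneg] u by blast
  moreover have "u \<bullet> f (f u) = f u \<bullet> f u"
    using symmetric_inner_commute[OF sym, of u "f u"]
    unfolding f_def[of "f u"] by (simp add: inner_diff_right) (simp add: f_def inner_diff_left)
  ultimately have "f u = 0" by simp
  then show thesis using that[of u l] u by (simp add: f_def)
qed

definition eigenbasis :: "real^'n^'n \<Rightarrow> (real^'n) set \<Rightarrow> (real^'n \<Rightarrow> real) \<Rightarrow> bool" where
  "eigenbasis X E l \<longleftrightarrow> finite E \<and> pairwise orthogonal E \<and> span E = UNIV
     \<and> (\<forall>u\<in>E. norm u = 1 \<and> X *v u = l u *\<^sub>R u)"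

lemma symmetric_eigenbasis:
  fixes X :: "real^'n^'n"
  assumes sym: "transpose X = X"
  obtains E l where "eigenbasis X E l"
proof -
  define good where
    "good E \<longleftrightarrow> pairwise orthogonal E \<and> (\<forall>u\<in>E. norm u = 1 \<and> (\<exists>l. X *v u = l *\<^sub>R u))" for E
  have fin: "finite E \<and> card E \<le> CARD('n)" if "good E" for E
  proof -
    have "independent E" using that by (intro pairwise_orthogonal_independent) (auto simp: good_def)
    then show ?thesis using independent_bound by force
  qed
  have "good {}" by (simp add: good_def)
  then obtain E where E: "good E" and max: "\<And>F. good F \<Longrightarrow> card F \<le> card E"
    using ex_has_greatest_nat[of good "{}" card "Suc (CARD('n))"] fin by (metis le_imp_less_Suc)
  let ?S = "{x. \<forall>u\<in>E. orthogonal u x}"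
  have sub: "subspace ?S" by (rule subspace_orthogonal_to_vectors)
  have "?S = {0}"
  proof (rule ccontr)
    assume ne: "?S \<noteq> {0}"
    have "X *v x \<in> ?S" if "x \<in> ?S" for x
    proof -
      have "u \<bullet> (X *v x) = 0" if uE: "u \<in> E" for u
      proof -
        obtain c where "X *v u = c *\<^sub>R u" using E uE unfolding good_def by blast
        then have "u \<bullet> (X *v x) = c * (u \<bullet> x)"
          using symmetric_inner_commute[OF sym, of u x] by simp
        then show ?thesis using uE \<open>x \<in> ?S\<close> by (simp add: orthogonal_def)
      qed
      then show ?thesis by (simp add: orthogonal_def)
    qed
    then obtain u l where u: "u \<in> ?S" "norm u = 1" "X *v u = l *\<^sub>R u"
      using symmetric_eigenvector_in_subspace[OF sym sub ne] by blast
    have "u \<notin> E" using u by (auto simp: orthogonal_def norm_eq_1)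
    moreover have "good (insert u E)"
      using E u by (auto simp: good_def pairwise_insert orthogonal_commute)
    ultimately show False using max[of "insert u E"] fin[OF E] by simp
  qed
  then have S0: "x = 0" if "\<And>u. u \<in> E \<Longrightarrow> orthogonal u x" for x using that by blast
  have "x \<in> span E" for x
  proof -
    obtain y z where yz: "y \<in> span E" "\<And>w. w \<in> span E \<Longrightarrow> orthogonal z w" "x = y + z"
      using orthogonal_subspace_decomp_exists[of E x] by blast
    have "z = 0" by (rule S0) (metis yz(2) span_base orthogonal_commute)
    then show ?thesis using yz by simp
  qed
  then have "span E = UNIV" by blast
  moreover obtain l where "\<forall>u\<in>E. X *v u = l u *\<^sub>R u"
    using E unfolding good_def by metis
  ultimately have "eigenbasis X E l"
    using E fin[OF E] by (auto simp: eigenbasis_def good_def)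
  then show thesis by (rule that)
qed

lemma matrix_eq_on_eigenbasis:
  assumes "eigenbasis X E l" "\<And>u. u \<in> E \<Longrightarrow> Y *v u = Z *v u"
  shows "Y = (Z :: real^'n^'m)"
proof -
  have "Y *v x = Z *v x" for x
    by (rule linear_eq_on_span[of "(*v) Y" "(*v) Z" E]) (use assms in \<open>auto simp: eigenbasis_def\<close>)
  then show ?thesis by (simp add: matrix_eq)
qed

lemma functional_calculus:
  fixes X :: "real^'n^'n"
  assumes E: "eigenbasis X E l"
  obtains Y where "transpose Y = Y" "\<And>u. u \<in> E \<Longrightarrow> Y *v u = g u *\<^sub>R u"
    "(\<And>u. u \<in> E \<Longrightarrow> 0 \<le> g u) \<Longrightarrow> psd Y"
proof -
  define Y :: "real^'n^'n" where "Y = (\<chi> i j. \<Sum>u\<in>E. g u * u $ i * u $ j)"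
  have Yx: "Y *v x = (\<Sum>u\<in>E. (g u * (u \<bullet> x)) *\<^sub>R u)" for x
    unfolding vec_eq_iff Y_def matrix_vector_mult_def inner_vec_def
    by (simp add: sum_distrib_left sum_distrib_right sum.swap[of _ E] mult_ac)
  have sym: "transpose Y = Y"
    by (simp add: Y_def transpose_def vec_eq_iff mult_ac)
  have "Y *v u = g u *\<^sub>R u" if "u \<in> E" for u
  proof -
    have *: "(g w * (w \<bullet> u)) *\<^sub>R w = (if w = u then g u *\<^sub>R u else 0)" if "w \<in> E" for w
      using E \<open>u \<in> E\<close> that
      by (auto simp: eigenbasis_def pairwise_def orthogonal_def norm_eq_1)
    show ?thesis unfolding Yx using E that by (simp add: * eigenbasis_def cong: sum.cong)
  qed
  moreover have "psd Y" if "\<And>u. u \<in> E \<Longrightarrow> 0 \<le> g u"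
  proof -
    have "x \<bullet> (Y *v x) = (\<Sum>u\<in>E. g u * (u \<bullet> x)^2)" for x
      by (simp add: Yx inner_sum_right power2_eq_square inner_commute mult_ac)
    then show ?thesis using that sym by (simp add: psd_def sum_nonneg)
  qed
  ultimately show thesis using sym that by blast
qed

lemma psd_eigenvalue_nonneg:
  assumes "psd X" "X *v u = l *\<^sub>R u" "norm u = 1"
  shows "0 \<le> l"
  using assms unfolding psd_def by (metis inner_scaleR_right norm_eq_1 mult.right_neutral)

lemma psd_sqrt_unique:
  fixes R T :: "real^'n^'n"
  assumes R: "psd R" and T: "psd T" and eq: "R ** R = T ** T"
  shows "T = R"
proof -
  obtain E l where E: "eigenbasis R E l" using R symmetric_eigenbasis psd_def by blast
  show ?thesis
  proof (rule matrix_eq_on_eigenbasis[OF E])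
    fix u assume "u \<in> E"
    then have u: "norm u = 1" "R *v u = l u *\<^sub>R u" using E by (auto simp: eigenbasis_def)
    let ?r = "l u"
    have r: "0 \<le> ?r" using psd_eigenvalue_nonneg[OF R u(2,1)] .
    have TT: "T *v (T *v u) = (?r * ?r) *\<^sub>R u"
      using arg_cong[OF eq, of "\<lambda>Z. Z *v u"] u
      by (simp add: matrix_vector_mul_assoc[symmetric] matrix_vector_mult_scaleR)
    define y where "y = T *v u - ?r *\<^sub>R u"
    have "T *v y = (- ?r) *\<^sub>R y"
      by (simp add: y_def TT matrix_vector_mult_diff_distrib matrix_vector_mult_scaleR algebra_simps)
    then have "- ?r * (y \<bullet> y) \<ge> 0"
      using T by (metis inner_scaleR_right psd_def)
    then have "?r = 0 \<or> y = 0"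
      using r by (smt (verit) inner_gt_zero_iff mult_minus_left mult_pos_pos)
    moreover have "y = 0" if "?r = 0"
    proof -
      have "(T *v u) \<bullet> (T *v u) = u \<bullet> (T *v (T *v u))"
        using T symmetric_inner_commute psd_def by blast
      then show ?thesis using that TT by (simp add: y_def)
    qed
    ultimately show "T *v u = R *v u" using u by (auto simp: y_def)
  qed
qed

lemma mat_sqrt_psd:
  fixes X :: "real^'n^'n"
  assumes "psd X"
  shows "psd (mat_sqrt X)" "mat_sqrt X ** mat_sqrt X = X"
proof -
  obtain E l where E: "eigenbasis X E l" using assms symmetric_eigenbasis psd_def by blast
  obtain R where R: "\<And>u. u \<in> E \<Longrightarrow> R *v u = sqrt (l u) *\<^sub>R u"
      "(\<And>u. u \<in> E \<Longrightarrow> 0 \<le> sqrt (l u)) \<Longrightarrow> psd R"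
    using functional_calculus[OF E, of "\<lambda>u. sqrt (l u)"] by metis
  have l: "0 \<le> l u" if "u \<in> E" for u
    using psd_eigenvalue_nonneg[OF assms] E that by (auto simp: eigenbasis_def)
  have "R ** R = X"
    by (rule matrix_eq_on_eigenbasis[OF E])
      (use R E l in \<open>simp add: matrix_vector_mul_assoc[symmetric] matrix_vector_mult_scaleR eigenbasis_def\<close>)
  moreover have "psd R" using R l by simp
  ultimately have "\<exists>!R. psd R \<and> R ** R = X"
    using psd_sqrt_unique by metis
  then have "psd (mat_sqrt X) \<and> mat_sqrt X ** mat_sqrt X = X"
    unfolding mat_sqrt_def by (rule theI')
  then show "psd (mat_sqrt X)" "mat_sqrt X ** mat_sqrt X = X" by auto
qed

lemma penrose_unique:
  fixes X :: "real^'n^'m"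
  assumes "X ** Y ** X = X" "Y ** X ** Y = Y"
      "transpose (X ** Y) = X ** Y" "transpose (Y ** X) = Y ** X"
    and "X ** Z ** X = X" "Z ** X ** Z = Z"
      "transpose (X ** Z) = X ** Z" "transpose (Z ** X) = Z ** X"
  shows "Y = Z"
proof -
  have "X ** Y = X ** Z"
  proof -
    have "X ** Y = transpose (X ** Z ** X ** Y)" using assms by simp
    also have "\<dots> = transpose (X ** Y) ** transpose (X ** Z)"
      by (simp add: matrix_transpose_mul matrix_mul_assoc)
    also have "\<dots> = X ** Z" using assms by (simp add: matrix_mul_assoc)
    finally show ?thesis .
  qed
  moreover have "Y ** X = Z ** X"
  proof -
    have "Y ** X = transpose (Y ** (X ** Z ** X))" using assms by simp
    also have "\<dots> = transpose (Z ** X) ** transpose (Y ** X)"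
      by (simp add: matrix_transpose_mul matrix_mul_assoc)
    also have "\<dots> = Z ** (X ** Y ** X)" unfolding assms(4,8) by (simp add: matrix_mul_assoc)
    also have "\<dots> = Z ** X" using assms(1) by simp
    finally show ?thesis .
  qed
  ultimately show ?thesis using assms by (metis matrix_mul_assoc)
qed

lemma symmetric_pinv:
  fixes X :: "real^'n^'n"
  assumes sym: "transpose X = X"
  shows "X ** pinv X ** X = X"
proof -
  obtain E l where E: "eigenbasis X E l" using sym symmetric_eigenbasis by blast
  obtain Y where Y: "transpose Y = Y" "\<And>u. u \<in> E \<Longrightarrow> Y *v u = inverse (l u) *\<^sub>R u"
    using functional_calculus[OF E, of "\<lambda>u. inverse (l u)"] by metis
  note simps = matrix_vector_mul_assoc[symmetric] matrix_vector_mult_scaleR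
  have X: "X *v u = l u *\<^sub>R u" if "u \<in> E" for u using E that by (simp add: eigenbasis_def)
  have l: "l u * inverse (l u) * l u = l u" "inverse (l u) * l u * inverse (l u) = inverse (l u)" for u
    by (cases "l u = 0"; simp)+
  have "X ** Y ** X = X"
    by (rule matrix_eq_on_eigenbasis[OF E]) (simp add: simps X Y l mult.assoc[symmetric] del: right_inverse left_inverse)
  moreover have "Y ** X ** Y = Y"
    by (rule matrix_eq_on_eigenbasis[OF E]) (simp add: simps X Y l mult.assoc[symmetric] del: right_inverse left_inverse)
  moreover have "X ** Y = Y ** X"
    by (rule matrix_eq_on_eigenbasis[OF E]) (simp add: simps X Y)
  ultimately have "\<exists>!Y. X ** Y ** X = X \<and> Y ** X ** Y = Y \<and>
                    transpose (X ** Y) = X ** Y \<and> transpose (Y ** X) = Y ** X"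
    using Y(1) sym by (intro ex1I[of _ Y]) (auto simp: matrix_transpose_mul intro: penrose_unique)
  from theI'[OF this] show ?thesis unfolding pinv_def by blast
qed

subsection \<open>The matrix exponential\<close>

lemma mat_pow_entry_bound:
  fixes X :: "real^'n^'n"
  shows "\<bar>mat_pow X k $ i $ j\<bar> \<le> (\<Sum>i\<in>UNIV. \<Sum>j\<in>UNIV. \<bar>X $ i $ j\<bar>) ^ k"
proof (induction k arbitrary: i)
  case 0 then show ?case by (simp add: mat_def)
next
  case (Suc k)
  let ?K = "\<Sum>i\<in>UNIV. \<Sum>j\<in>UNIV. \<bar>X $ i $ j\<bar>"
  have "\<bar>mat_pow X (Suc k) $ i $ j\<bar> \<le> (\<Sum>l\<in>UNIV. \<bar>X $ i $ l * mat_pow X k $ l $ j\<bar>)"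
    by (simp add: matrix_matrix_mult_def sum_abs)
  also have "\<dots> \<le> (\<Sum>l\<in>UNIV. \<bar>X $ i $ l\<bar> * ?K ^ k)"
    unfolding abs_mult by (intro sum_mono mult_left_mono Suc.IH) simp
  also have "\<dots> = (\<Sum>l\<in>UNIV. \<bar>X $ i $ l\<bar>) * ?K ^ k" by (simp add: sum_distrib_right)
  also have "\<dots> \<le> ?K * ?K ^ k"
    by (intro mult_right_mono member_le_sum[of i UNIV "\<lambda>i. \<Sum>l\<in>UNIV. \<bar>X $ i $ l\<bar>"] zero_le_power sum_nonneg) auto
  finally show ?case by simp
qed

lemma mat_pow_scaleR: "mat_pow (t *\<^sub>R X) k = t ^ k *\<^sub>R mat_pow X k"
  by (induction k) (simp_all add: scalar_matrix_assoc matrix_scalar_ac mult.commute)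

lemma mat_pow_commute: "mat_pow X k ** X = X ** mat_pow X k"
  by (induction k) (simp_all add: matrix_mul_assoc[symmetric])

lemma mat_pow_transpose: "mat_pow (transpose X) k = transpose (mat_pow X k)"
  by (induction k) (simp_all add: transpose_mat matrix_transpose_mul mat_pow_commute[symmetric])

lemma mat_exp_entry_summable:
  fixes X :: "real^'n^'n"
  shows "summable (\<lambda>k. mat_pow X k $ i $ j / fact k * t ^ k)"
proof (rule summable_comparison_test)
  let ?K = "\<Sum>i\<in>UNIV. \<Sum>j\<in>UNIV. \<bar>X $ i $ j\<bar>"
  have "norm (mat_pow X k $ i $ j / fact k * t ^ k) \<le> inverse (fact k) * (?K * \<bar>t\<bar>) ^ k" for k
    using mult_right_mono[OF mat_pow_entry_bound[of X k i j], of "\<bar>t\<bar> ^ k"]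
    by (simp add: abs_mult power_abs power_mult_distrib divide_simps)
  then show "\<exists>N. \<forall>k\<ge>N. norm (mat_pow X k $ i $ j / fact k * t ^ k) \<le> inverse (fact k) * (?K * \<bar>t\<bar>) ^ k"
    by blast
  show "summable (\<lambda>k. inverse (fact k) * (?K * \<bar>t\<bar>) ^ k)"
    by (rule summable_exp)
qed

lemma mat_exp_sums:
  fixes X :: "real^'n^'n"
  shows "(\<lambda>k. mat_pow (t *\<^sub>R X) k /\<^sub>R fact k) sums
    (\<chi> i j. \<Sum>k. mat_pow X k $ i $ j / fact k * t ^ k)" (is "_ sums ?Y")
  unfolding sums_def
proof (intro vec_tendstoI)
  fix i j
  have "(\<lambda>k. mat_pow X k $ i $ j / fact k * t ^ k) sums (?Y $ i $ j)"
    using summable_sums[OF mat_exp_entry_summable] by simp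
  then show "(\<lambda>n. (\<Sum>k<n. mat_pow (t *\<^sub>R X) k /\<^sub>R fact k) $ i $ j) \<longlonglongrightarrow> ?Y $ i $ j"
    by (simp add: sums_def mat_pow_scaleR divide_inverse mult_ac)
qed

lemma mat_exp_entry:
  fixes X :: "real^'n^'n"
  shows "mat_exp (t *\<^sub>R X) $ i $ j = (\<Sum>k. mat_pow X k $ i $ j / fact k * t ^ k)"
  using mat_exp_sums[of t X] by (simp add: mat_exp_def sums_iff)

lemma mat_exp_kernel:
  fixes X :: "real^'n^'n"
  assumes "X *v z = 0"
  shows "mat_exp (t *\<^sub>R X) *v z = z"
proof -
  have bl: "bounded_linear (\<lambda>Y :: real^'n^'n. Y *v z)"
    by (simp add: linear_conv_bounded_linear[symmetric] linear_iff matrix_vector_mult_add_rdistrib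
        scaleR_matrix_vector_assoc)
  have pow: "mat_pow X k *v z = (if k = 0 then z else 0)" for k
    by (induction k) (auto simp: assms matrix_vector_mul_assoc[symmetric])
  have "mat_exp (t *\<^sub>R X) *v z = (\<Sum>k. (mat_pow (t *\<^sub>R X) k /\<^sub>R fact k) *v z)"
    unfolding mat_exp_def using bounded_linear.suminf[OF bl sums_summable[OF mat_exp_sums]] .
  also have "\<dots> = (\<Sum>k. if k = 0 then z else 0)"
    by (intro suminf_cong) (simp add: mat_pow_scaleR scaleR_matrix_vector_assoc[symmetric] pow)
  also have "\<dots> = z"
    using sums_single[of 0 "\<lambda>_. z"] by (simp add: sums_iff)
  finally show ?thesis .
qed

lemma mat_exp_zero: "mat_exp 0 = (mat 1 :: real^'n^'n)"
proof -
  have "mat_exp 0 $ i $ j = (mat 1 :: real^'n^'n) $ i $ j" for i j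
    using mat_exp_entry[of 0 "0 :: real^'n^'n" i j]
      powser_zero[of "\<lambda>k. mat_pow (0 :: real^'n^'n) k $ i $ j / fact k"] by simp
  then show ?thesis by (simp add: vec_eq_iff)
qed

lemma mat_exp_transpose: "mat_exp (t *\<^sub>R transpose X) = transpose (mat_exp (t *\<^sub>R X))"
  by (simp add: vec_eq_iff mat_exp_entry mat_pow_transpose) (simp add: transpose_def mat_exp_entry)

lemma mat_exp_has_derivative_entry:
  fixes X :: "real^'n^'n"
  shows "((\<lambda>t. mat_exp (t *\<^sub>R X) $ i $ j) has_real_derivative (X ** mat_exp (t *\<^sub>R X)) $ i $ j) (at t)"
proof -
  let ?c = "\<lambda>i k. mat_pow X k $ i $ j / fact k"
  have "((\<lambda>t. \<Sum>k. ?c i k * t ^ k) has_real_derivative (\<Sum>k. diffs (?c i) k * t ^ k)) (at t)"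
    by (rule termdiffs_strong_converges_everywhere[OF mat_exp_entry_summable])
  moreover have "diffs (?c i) k = (\<Sum>l\<in>UNIV. X $ i $ l * ?c l k)" for k
    by (simp add: diffs_def matrix_matrix_mult_def sum_divide_distrib sum_distrib_left del: of_nat_Suc)
  then have "(\<Sum>k. diffs (?c i) k * t ^ k) = (\<Sum>k. \<Sum>l\<in>UNIV. X $ i $ l * (?c l k * t ^ k))"
    by (simp add: sum_distrib_left mult_ac)
  also have "\<dots> = (\<Sum>l\<in>UNIV. \<Sum>k. X $ i $ l * (?c l k * t ^ k))"
    by (rule suminf_sum) (intro summable_mult mat_exp_entry_summable)
  also have "\<dots> = (X ** mat_exp (t *\<^sub>R X)) $ i $ j"
    by (simp only: matrix_matrix_mult_def vec_lambda_beta mat_exp_entry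
        suminf_mult[OF mat_exp_entry_summable])
  ultimately show ?thesis by (simp add: mat_exp_entry)
qed

lemma mat_exp_flow:
  fixes X :: "real^'n^'n"
  shows "((\<lambda>t. mat_exp (t *\<^sub>R X) *v x) has_vector_derivative X *v (mat_exp (t *\<^sub>R X) *v x)) (at t)"
proof -
  have "((\<lambda>t. (mat_exp (t *\<^sub>R X) *v x) $ i) has_real_derivative
          (X *v (mat_exp (t *\<^sub>R X) *v x)) $ i) (at t)" for i
    unfolding matrix_vector_mul_assoc
    unfolding matrix_vector_mult_def vec_lambda_beta
    by (auto intro!: derivative_eq_intros mat_exp_has_derivative_entry sum.cong)
  then show ?thesis
    unfolding has_vector_derivative_def has_field_derivative_def
    by (subst has_derivative_componentwise_within)
       (auto simp: Basis_vec_def inner_axis mult.commute[of _ "_ $ _"] scaleR_vec_def intro!: has_derivative_eq_rhs)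
qed

lemma quadratic_form_flow_derivative:
  fixes A P :: "real^'n^'n"
  defines "y \<equiv> \<lambda>x t. mat_exp (t *\<^sub>R A) *v x"
  shows "((\<lambda>t. y x t \<bullet> (P *v y x t)) has_real_derivative
           y x t \<bullet> ((P ** A + transpose A ** P) *v y x t)) (at t)"
proof -
  have "(y x has_vector_derivative A *v y x t) (at t)" unfolding y_def by (rule mat_exp_flow)
  note d = this bounded_linear.has_vector_derivative[OF matrix_vector_mul_bounded_linear[of P] this]
  have "((\<lambda>t. y x t \<bullet> (P *v y x t)) has_vector_derivative
           y x t \<bullet> (P *v (A *v y x t)) + (A *v y x t) \<bullet> (P *v y x t)) (at t)"
    by (rule bounded_bilinear.has_vector_derivative[OF bounded_bilinear_inner d])
  moreover have "(A *v y x t) \<bullet> (P *v y x t) = y x t \<bullet> (transpose A *v (P *v y x t))"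
    by (metis dot_lmul_matrix vector_transpose_matrix)
  ultimately show ?thesis
    by (simp add: has_real_derivative_iff_has_vector_derivative matrix_vector_mult_add_rdistrib
        inner_add_right matrix_vector_mul_assoc del: transpose_matrix_vector)
qed

subsection \<open>Lyapunov stability and the H2 norm\<close>

lemma has_integral_to_infinity_nonneg:
  fixes f F :: "real \<Rightarrow> real"
  assumes deriv: "\<And>t. (F has_real_derivative f t) (at t)"
    and nonneg: "\<And>t. 0 \<le> f t"
    and lim: "(F \<longlongrightarrow> l) at_top"
  shows "(f has_integral (l - F 0)) {0..}"
proof (rule has_integral_monotone_convergence_increasing[where
      f = "\<lambda>k t. if t \<in> {0..real k} then f t else 0" and x = "\<lambda>k. F (real k) - F 0"])
  fix k :: nat
  have "(f has_integral (F (real k) - F 0)) {0..real k}"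
    by (rule fundamental_theorem_of_calculus)
      (auto simp: has_real_derivative_iff_has_vector_derivative[symmetric] intro: deriv has_field_derivative_at_within)
  then show "((\<lambda>t. if t \<in> {0..real k} then f t else 0) has_integral (F (real k) - F 0)) {0..}"
    by (subst has_integral_restrict) auto
next
  show "(if t \<in> {0..real k} then f t else 0) \<le> (if t \<in> {0..real (Suc k)} then f t else 0)"
    for k t using nonneg by auto
next
  fix t :: real assume "t \<in> {0..}"
  obtain n where n: "t \<le> real n" using real_arch_simple by blast
  have "eventually (\<lambda>k. (if t \<in> {0..real k} then f t else 0) = f t) sequentially"
    using eventually_ge_at_top[of n] by eventually_elim (use n \<open>t \<in> {0..}\<close> in auto)
  then show "(\<lambda>k. if t \<in> {0..real k} then f t else 0) \<longlonglongrightarrow> f t"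
    by (rule tendsto_eventually)
next
  show "(\<lambda>k. F (real k) - F 0) \<longlonglongrightarrow> l - F 0"
    by (intro tendsto_intros filterlim_compose[OF lim filterlim_real_sequentially])
qed

lemma quadratic_form_lower_bound:
  fixes R :: "real^'n^'n"
  assumes H: "subspace H" and pos: "\<And>x. x \<in> H \<Longrightarrow> x \<noteq> 0 \<Longrightarrow> 0 < x \<bullet> (R *v x)"
  obtains c where "0 < c" "\<And>x. x \<in> H \<Longrightarrow> c * (norm x)\<^sup>2 \<le> x \<bullet> (R *v x)"
proof (cases "H \<inter> sphere 0 1 = {}")
  case True
  have "x = 0" if "x \<in> H" for x
  proof (rule ccontr)
    assume "x \<noteq> 0"
    then have "x /\<^sub>R norm x \<in> H \<inter> sphere 0 1" using that H by (simp add: subspace_scale)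
    then show False using True by blast
  qed
  then show thesis using that[of 1] by force
next
  case False
  have "compact (H \<inter> sphere 0 1)"
    using closed_subspace[OF H] compact_sphere by (simp add: closed_Int_compact)
  moreover have "continuous_on (H \<inter> sphere 0 1) (\<lambda>x. x \<bullet> (R *v x))"
    by (intro continuous_intros)
  ultimately obtain u where u: "u \<in> H \<inter> sphere 0 1"
      and min: "\<And>y. y \<in> H \<inter> sphere 0 1 \<Longrightarrow> u \<bullet> (R *v u) \<le> y \<bullet> (R *v y)"
    using continuous_attains_inf[of "H \<inter> sphere 0 1" "\<lambda>x. x \<bullet> (R *v x)"] False by blast
  show thesis
  proof (rule that)
    show "0 < u \<bullet> (R *v u)" using u pos by force
    show "u \<bullet> (R *v u) * (norm x)\<^sup>2 \<le> x \<bullet> (R *v x)" if "x \<in> H" for x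
    proof (cases "x = 0")
      case False
      then have "x /\<^sub>R norm x \<in> H \<inter> sphere 0 1" using that H by (simp add: subspace_scale)
      from min[OF this] show ?thesis
        using False by (simp add: matrix_vector_mult_scaleR power2_eq_square field_simps)
    qed simp
  qed
qed

lemma quadratic_form_upper_bound:
  fixes R :: "real^'n^'n"
  obtains K where "0 < K" "\<And>x. x \<bullet> (R *v x) \<le> K * (norm x)\<^sup>2"
proof -
  obtain K where K: "0 < K" "\<And>x. norm (R *v x) \<le> norm x * K"
    using bounded_linear.pos_bounded[OF matrix_vector_mul_bounded_linear[of R]] by blast
  have "x \<bullet> (R *v x) \<le> K * (norm x)\<^sup>2" for x
    using norm_cauchy_schwarz[of x "R *v x"] mult_left_mono[OF K(2)[of x], of "norm x"]
    by (simp add: power2_eq_square mult_ac)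
  then show thesis using that K by blast
qed

lemma linear_invariant_flow:
  fixes A :: "real^'n^'n"
  assumes "\<And>w. h \<bullet> (A *v w) = 0"
  shows "h \<bullet> (mat_exp (t *\<^sub>R A) *v x) = h \<bullet> x"
proof -
  have "((\<lambda>t. h \<bullet> (mat_exp (t *\<^sub>R A) *v x)) has_real_derivative 0) (at t)" for t
    using bounded_linear.has_vector_derivative[OF bounded_linear_inner_right[of h] mat_exp_flow[of A x t]]
    by (simp add: has_real_derivative_iff_has_vector_derivative assms)
  from DERIV_const_ratio_const[of t 0, where f = "\<lambda>t. h \<bullet> (mat_exp (t *\<^sub>R A) *v x)", OF _ this]
  show ?thesis by (cases "t = 0") (auto simp: mat_exp_zero)
qed

lemma lyapunov_asymptotic_stability:
  fixes A R :: "real^'n^'n"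
  assumes H: "subspace H" and inv: "\<And>x t. x \<in> H \<Longrightarrow> mat_exp (t *\<^sub>R A) *v x \<in> H"
    and pos: "\<And>x. x \<in> H \<Longrightarrow> x \<noteq> 0 \<Longrightarrow> 0 < x \<bullet> (R *v x)"
    and neg: "\<And>x. x \<in> H \<Longrightarrow> x \<noteq> 0 \<Longrightarrow> x \<bullet> ((R ** A + transpose A ** R) *v x) < 0"
    and x: "x \<in> H"
  shows "((\<lambda>t. mat_exp (t *\<^sub>R A) *v x) \<longlongrightarrow> 0) at_top"
proof -
  let ?Q = "R ** A + transpose A ** R"
  obtain c where c: "0 < c" "\<And>x. x \<in> H \<Longrightarrow> c * (norm x)\<^sup>2 \<le> x \<bullet> (R *v x)"
    using quadratic_form_lower_bound[OF H pos] by blast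
  have "0 < x \<bullet> (- ?Q *v x)" if "x \<in> H" "x \<noteq> 0" for x
    using neg[OF that] matrix_vector_mult_diff_rdistrib[of 0 ?Q x] by simp
  then obtain q where q: "0 < q" "\<And>x. x \<in> H \<Longrightarrow> q * (norm x)\<^sup>2 \<le> x \<bullet> (- ?Q *v x)"
    using quadratic_form_lower_bound[OF H] by blast
  obtain K where K: "0 < K" "\<And>x. x \<bullet> (R *v x) \<le> K * (norm x)\<^sup>2"
    using quadratic_form_upper_bound[of R] by blast
  define r where "r = q / K"
  define y where "y t = mat_exp (t *\<^sub>R A) *v x" for t
  define V where "V t = y t \<bullet> (R *v y t)" for t
  have r: "0 < r" using q K by (simp add: r_def)
  have yH: "y t \<in> H" for t using inv x by (simp add: y_def)
  have V': "(V has_real_derivative y t \<bullet> (?Q *v y t)) (at t)" for t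
    unfolding V_def y_def by (rule quadratic_form_flow_derivative)
  have V'_le: "y t \<bullet> (?Q *v y t) \<le> - r * V t" for t
  proof -
    have "r * V t \<le> q * (norm (y t))\<^sup>2"
      using mult_left_mono[OF K(2)[of "y t"], of r] r K(1) by (simp add: V_def r_def)
    moreover have "q * (norm (y t))\<^sup>2 \<le> - (y t \<bullet> (?Q *v y t))"
      using q(2)[OF yH[of t]] matrix_vector_mult_diff_rdistrib[of 0 ?Q "y t"] by simp
    ultimately show ?thesis by simp
  qed
  have "exp (r * t) * V t \<le> exp (r * 0) * V 0" if "0 \<le> t" for t
  proof (rule DERIV_nonpos_imp_nonincreasing[OF that])
    fix s :: real
    have "((\<lambda>s. exp (r * s) * V s) has_real_derivative exp (r * s) * (r * V s + y s \<bullet> (?Q *v y s))) (at s)"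
      by (auto intro!: derivative_eq_intros V' simp: algebra_simps)
    moreover have "exp (r * s) * (r * V s + y s \<bullet> (?Q *v y s)) \<le> 0"
      using V'_le[of s] by (intro mult_nonneg_nonpos) auto
    ultimately show "\<exists>z. ((\<lambda>s. exp (r * s) * V s) has_real_derivative z) (at s) \<and> z \<le> 0" by blast
  qed
  then have "exp (r * t) * V t \<le> V 0" if "0 \<le> t" for t
    using that by simp
  then have V_le: "V t \<le> V 0 * exp (- r * t)" if "0 \<le> t" for t
    using mult_right_mono[of "exp (r * t) * V t" "V 0" "exp (- r * t)"] that
    by (simp add: mult.assoc mult.left_commute exp_add[symmetric])
  have "((\<lambda>t. V 0 / c * exp (- r * t)) \<longlongrightarrow> V 0 / c * 0) at_top"
    using r by (intro tendsto_mult tendsto_const filterlim_compose[OF exp_at_bot]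
        filterlim_tendsto_neg_mult_at_bot[OF tendsto_const] filterlim_ident) simp
  moreover have "eventually (\<lambda>t. norm ((norm (y t))\<^sup>2) \<le> V 0 / c * exp (- r * t)) at_top"
    using eventually_ge_at_top[of 0]
  proof eventually_elim
    case (elim t)
    show ?case using order_trans[OF c(2)[OF yH] V_le[OF elim, unfolded V_def[of t]]] c(1)
      by (simp add: field_simps)
  qed
  ultimately have "((\<lambda>t. (norm (y t))\<^sup>2) \<longlongrightarrow> 0) at_top"
    by (intro Lim_null_comparison[of "\<lambda>t. (norm (y t))\<^sup>2" "\<lambda>t. V 0 / c * exp (- r * t)"]) simp_all
  from tendsto_real_sqrt[OF this] have "((\<lambda>t. norm (y t)) \<longlongrightarrow> 0) at_top" by simp
  then show ?thesis unfolding y_def by (simp add: tendsto_norm_zero_iff)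
qed

lemma trace_quadratic_form:
  fixes P :: "real^'n^'n" and B :: "real^'m^'n"
  shows "trace (transpose B ** P ** B) = (\<Sum>j\<in>UNIV. column j B \<bullet> (P *v column j B))"
  unfolding trace_def matrix_mul_assoc[symmetric]
  by (simp add: matrix_matrix_mult_def transpose_def inner_vec_def column_def matrix_vector_mult_def)

lemma column_matrix_mult: "column j (X ** B) = X *v column j B"
  by (simp add: vec_eq_iff column_def matrix_matrix_mult_def matrix_vector_mult_def)

lemma h2_integrand_output_energy:
  "h2_integrand A B C t = (\<Sum>j\<in>UNIV. (norm (C *v (mat_exp (t *\<^sub>R A) *v column j B)))\<^sup>2)"
proof -
  have "h2_integrand A B C t = trace (transpose (mat_exp (t *\<^sub>R A) ** B) ** (transpose C ** C) ** (mat_exp (t *\<^sub>R A) ** B))"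
    by (simp add: h2_integrand_def mat_exp_transpose matrix_transpose_mul matrix_mul_assoc)
  also have "\<dots> = (\<Sum>j\<in>UNIV. (norm (C *v (mat_exp (t *\<^sub>R A) *v column j B)))\<^sup>2)"
    unfolding trace_quadratic_form column_matrix_mult matrix_vector_mul_assoc[symmetric] power2_norm_eq_inner
    by (intro sum.cong refl) (metis dot_lmul_matrix vector_transpose_matrix transpose_transpose)
  finally show ?thesis .
qed

lemma lyapunov_output_energy:
  fixes A P :: "real^'n^'n" and C :: "real^'n^'q"
  defines "y \<equiv> \<lambda>x t. mat_exp (t *\<^sub>R A) *v x"
  assumes lyap: "P ** A + transpose A ** P + transpose C ** C = 0"
    and lim: "((\<lambda>t. y x t \<bullet> (P *v y x t)) \<longlongrightarrow> 0) at_top"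
  shows "((\<lambda>t. (norm (C *v y x t))\<^sup>2) has_integral x \<bullet> (P *v x)) {0..}"
proof -
  have Q: "P ** A + transpose A ** P = - (transpose C ** C)"
    using lyap by (simp add: eq_neg_iff_add_eq_0)
  have CC: "z \<bullet> ((transpose C ** C) *v z) = (norm (C *v z))\<^sup>2" for z
    by (simp only: matrix_vector_mul_assoc[symmetric] power2_norm_eq_inner)
      (metis dot_lmul_matrix vector_transpose_matrix transpose_transpose)
  have "z \<bullet> ((P ** A + transpose A ** P) *v z) = - (norm (C *v z))\<^sup>2" for z
    using matrix_vector_mult_diff_rdistrib[of 0 "transpose C ** C" z] CC[of z] by (simp add: Q)
  then have "((\<lambda>t. - (y x t \<bullet> (P *v y x t))) has_real_derivative (norm (C *v y x t))\<^sup>2) (at t)" for t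
    using DERIV_minus[OF quadratic_form_flow_derivative[of A x P t]] by (simp add: y_def)
  moreover have "((\<lambda>t. - (y x t \<bullet> (P *v y x t))) \<longlongrightarrow> 0) at_top"
    using tendsto_minus[OF lim] by simp
  ultimately show ?thesis
    using has_integral_to_infinity_nonneg[of "\<lambda>t. - (y x t \<bullet> (P *v y x t))" "\<lambda>t. (norm (C *v y x t))\<^sup>2" 0]
    by (simp add: y_def mat_exp_zero)
qed

lemma h2_integrand_has_integral:
  fixes A P :: "real^'n^'n" and C :: "real^'n^'q" and B :: "real^'m^'n"
  assumes "P ** A + transpose A ** P + transpose C ** C = 0"
    and "\<And>x. ((\<lambda>t. (mat_exp (t *\<^sub>R A) *v x) \<bullet> (P *v (mat_exp (t *\<^sub>R A) *v x))) \<longlongrightarrow> 0) at_top"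
  shows "(h2_integrand A B C has_integral trace (transpose B ** P ** B)) {0..}"
  unfolding trace_quadratic_form h2_integrand_output_energy[abs_def]
  by (intro has_integral_sum lyapunov_output_energy assms) simp

subsection \<open>Laplacians, diagonal and block matrices\<close>

lemma transpose_laplacian: "graph_weights w \<Longrightarrow> transpose (laplacian w) = laplacian w"
  by (auto simp: graph_weights_def laplacian_def transpose_def vec_eq_iff)

lemma laplacian_mult_vec:
  "(laplacian w *v x) $ i = (\<Sum>j\<in>UNIV - {i}. w i j * (x $ i - x $ j))"
proof -
  have "(laplacian w *v x) $ i = (\<Sum>k\<in>UNIV - {i}. w i k) * x $ i + (\<Sum>j\<in>UNIV - {i}. - w i j * x $ j)"
    by (simp add: laplacian_def matrix_vector_mult_def sum.remove[of UNIV i])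
  then show ?thesis
    by (simp add: sum_distrib_right right_diff_distrib sum_subtractf sum_negf)
qed

lemma laplacian_quadratic_form:
  fixes x :: "real^'n"
  assumes "graph_weights w"
  shows "x \<bullet> (laplacian w *v x) = (\<Sum>i\<in>UNIV. \<Sum>j\<in>UNIV - {i}. w i j * (x $ i - x $ j)\<^sup>2) / 2"
proof -
  let ?w = "\<lambda>i j. if i = j then 0 else w i j"
  have w: "?w i j = ?w j i" for i j using assms by (simp add: graph_weights_def)
  have off: "(\<Sum>j\<in>UNIV - {i}. w i j * f j) = (\<Sum>j\<in>UNIV. ?w i j * f j)" for i and f :: "'n \<Rightarrow> real"
    by (rule sum.mono_neutral_cong_left) auto
  have form: "x \<bullet> (laplacian w *v x) = (\<Sum>i\<in>UNIV. \<Sum>j\<in>UNIV. ?w i j * (x $ i * (x $ i - x $ j)))"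
    unfolding inner_vec_def laplacian_mult_vec off
    by (simp add: sum_distrib_left mult_ac)
  also have "\<dots> = (\<Sum>j\<in>UNIV. \<Sum>i\<in>UNIV. ?w i j * (x $ i * (x $ i - x $ j)))" by (rule sum.swap)
  also have "\<dots> = (\<Sum>i\<in>UNIV. \<Sum>j\<in>UNIV. ?w i j * (x $ j * (x $ j - x $ i)))"
    by (simp only: w[symmetric])
  finally have "2 * (x \<bullet> (laplacian w *v x)) =
      (\<Sum>i\<in>UNIV. \<Sum>j\<in>UNIV. ?w i j * (x $ i * (x $ i - x $ j)) + ?w i j * (x $ j * (x $ j - x $ i)))"
    unfolding sum.distrib using form by simp
  also have "\<dots> = (\<Sum>i\<in>UNIV. \<Sum>j\<in>UNIV. ?w i j * (x $ i - x $ j)\<^sup>2)"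
    by (intro sum.cong refl) (simp add: power2_eq_square algebra_simps)
  finally show ?thesis unfolding off by simp
qed

lemma psd_laplacian: "graph_weights w \<Longrightarrow> psd (laplacian w)"
  by (auto simp: psd_def transpose_laplacian laplacian_quadratic_form graph_weights_def intro!: sum_nonneg mult_nonneg_nonneg)

lemma laplacian_mult_one: "laplacian w *v 1 = 0"
  by (simp add: vec_eq_iff laplacian_mult_vec)

lemma laplacian_form_zero_imp_const:
  fixes x :: "real^'n"
  assumes w: "graph_weights w" "graph_connected w" and zero: "x \<bullet> (laplacian w *v x) = 0"
  shows "x $ i = x $ j"
proof -
  have nonneg: "0 \<le> w i j * (x $ i - x $ j)\<^sup>2" if "j \<in> UNIV - {i}" for i j
    using that w(1) by (auto simp: graph_weights_def)
  have "(\<Sum>i\<in>UNIV. \<Sum>j\<in>UNIV - {i}. w i j * (x $ i - x $ j)\<^sup>2) = 0"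
    using zero laplacian_quadratic_form[OF w(1), of x] by simp
  then have "(\<Sum>j\<in>UNIV - {i}. w i j * (x $ i - x $ j)\<^sup>2) = 0" for i
    by (subst (asm) sum_nonneg_eq_0_iff) (auto intro: sum_nonneg nonneg)
  then have zero: "w i j * (x $ i - x $ j)\<^sup>2 = 0" if "i \<noteq> j" for i j
    using sum_nonneg_eq_0_iff[of "UNIV - {i}" "\<lambda>j. w i j * (x $ i - x $ j)\<^sup>2"] nonneg[of _ i] that by auto
  have edge: "x $ k = x $ l" if "k \<noteq> l" "0 < w k l" for k l
    using zero[OF that(1)] that(2) by simp
  have "(i, j) \<in> {(k, l). k \<noteq> l \<and> 0 < w k l}\<^sup>*"
    using w(2) by (simp add: graph_connected_def)
  then show ?thesis
    by (induction rule: rtrancl_induct) (auto dest: edge)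
qed

lemma laplacian_kernel_const:
  fixes x :: "real^'n"
  assumes "graph_weights w" "graph_connected w" "laplacian w *v x = 0"
  shows "x $ i = x $ j"
  by (rule laplacian_form_zero_imp_const[OF assms(1,2)]) (simp add: assms(3))

lemma laplacian_mult_zero_imp_rows_eq:
  fixes X :: "real^'m^'n"
  assumes "graph_weights w" "graph_connected w" "laplacian w ** X = 0"
  shows "X $ i $ k = X $ j $ k"
proof -
  have "laplacian w *v column k X = 0"
    using assms(3) unfolding column_matrix_mult[symmetric] by (simp add: column_def vec_eq_iff)
  from laplacian_kernel_const[OF assms(1,2) this, of i j] show ?thesis by (simp add: column_def)
qed

lemma diag_mat_mult_entry: "(diag_mat x ** X) $ i $ j = x $ i * X $ i $ j"
  by (simp add: diag_mat_def matrix_matrix_mult_def if_distrib if_distribR cong: if_cong)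

lemma mult_diag_mat_entry: "(X ** diag_mat x) $ i $ j = X $ i $ j * x $ j"
  by (simp add: diag_mat_def matrix_matrix_mult_def if_distrib if_distribR cong: if_cong)

lemma diag_mat_mult_vec: "(diag_mat x *v y) $ i = x $ i * y $ i"
  by (simp add: diag_mat_def matrix_vector_mult_def if_distrib if_distribR cong: if_cong)

lemma transpose_diag_mat: "transpose (diag_mat x) = diag_mat x"
  by (simp add: diag_mat_def transpose_def vec_eq_iff)

lemma diag_mat_quadratic_form: "y \<bullet> (diag_mat x *v y) = (\<Sum>i\<in>UNIV. x $ i * (y $ i)\<^sup>2)"
  by (simp add: inner_vec_def diag_mat_mult_vec power2_eq_square mult_ac)

lemma psd_diag_mat: "(\<And>i. 0 \<le> x $ i) \<Longrightarrow> psd (diag_mat x)"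
  by (auto simp: psd_def transpose_diag_mat diag_mat_quadratic_form intro!: sum_nonneg)

lemma matrix_inv_unique:
  fixes X Y :: "real^'n^'n"
  assumes "X ** Y = mat 1" "Y ** X = mat 1"
  shows "matrix_inv X = Y"
proof -
  have "X ** matrix_inv X = mat 1 \<and> matrix_inv X ** X = mat 1"
    unfolding matrix_inv_def using assms by (rule someI_ex[OF exI[of _ Y], OF conjI])
  then show ?thesis by (metis assms(2) matrix_mul_assoc matrix_mul_lid matrix_mul_rid)
qed

lemma matrix_inv_diag_mat:
  assumes "\<And>i. x $ i \<noteq> 0"
  shows "matrix_inv (diag_mat x) = diag_mat (\<chi> i. inverse (x $ i))"
proof (rule matrix_inv_unique)
  show "diag_mat x ** diag_mat (\<chi> i. inverse (x $ i)) = mat 1"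
    using assms by (simp add: vec_eq_iff diag_mat_mult_entry) (simp add: diag_mat_def mat_def)
  show "diag_mat (\<chi> i. inverse (x $ i)) ** diag_mat x = mat 1"
    using assms by (simp add: vec_eq_iff diag_mat_mult_entry) (simp add: diag_mat_def mat_def)
qed

definition block_vec :: "real^'r \<Rightarrow> real^'q \<Rightarrow> real^('r + 'q)" where
  "block_vec x y = (\<chi> i. case i of Inl i \<Rightarrow> x $ i | Inr i \<Rightarrow> y $ i)"

lemma block_vec_exists: obtains x y where "z = block_vec x y"
proof -
  have "z = block_vec (\<chi> i. z $ Inl i) (\<chi> i. z $ Inr i)"
    by (auto simp: block_vec_def vec_eq_iff split: sum.split)
  then show thesis by (rule that)
qed

lemma block_mat_exists: obtains W X Y Z where "P = block_mat W X Y Z"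
proof -
  have "P = block_mat (\<chi> i j. P $ Inl i $ Inl j) (\<chi> i j. P $ Inl i $ Inr j)
      (\<chi> i j. P $ Inr i $ Inl j) (\<chi> i j. P $ Inr i $ Inr j)"
    by (auto simp: block_mat_def vec_eq_iff split: sum.split)
  then show thesis by (rule that)
qed

lemma sum_UNIV_sum_type:
  fixes f :: "'a::finite + 'b::finite \<Rightarrow> 'c::comm_monoid_add"
  shows "sum f UNIV = (\<Sum>i\<in>UNIV. f (Inl i)) + (\<Sum>i\<in>UNIV. f (Inr i))"
  using sum.Plus[of UNIV UNIV f] by simp

lemma block_vec_inner: "block_vec x y \<bullet> block_vec u v = x \<bullet> u + y \<bullet> v"
  by (simp add: inner_vec_def block_vec_def sum_UNIV_sum_type)

lemma block_vec_eq_zero_iff: "block_vec x y = 0 \<longleftrightarrow> x = 0 \<and> y = 0"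
  by (auto simp: block_vec_def vec_eq_iff split: sum.splits)

lemma block_vec_eq_iff: "block_vec x y = block_vec u v \<longleftrightarrow> x = u \<and> y = v"
  by (auto simp: block_vec_def vec_eq_iff split: sum.splits)

lemma z0_eq_block_vec: "z0 = block_vec 1 0"
  by (auto simp: z0_def block_vec_def vec_eq_iff split: sum.split)

lemma block_mat_mult_vec:
  "block_mat W X Y Z *v block_vec x y = block_vec (W *v x + X *v y) (Y *v x + Z *v y)"
  by (auto simp: block_mat_def block_vec_def matrix_vector_mult_def vec_eq_iff sum_UNIV_sum_type split: sum.split)

lemma block_mat_mult:
  "block_mat W X Y Z ** block_mat W' X' Y' Z'
    = block_mat (W ** W' + X ** Y') (W ** X' + X ** Z') (Y ** W' + Z ** Y') (Y ** X' + Z ** Z')"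
  by (auto simp: block_mat_def matrix_matrix_mult_def vec_eq_iff sum_UNIV_sum_type split: sum.split)

lemma block_mat_mult_block_col:
  "block_mat W X Y Z ** block_col U V = block_col (W ** U + X ** V) (Y ** U + Z ** V)"
  by (auto simp: block_mat_def block_col_def matrix_matrix_mult_def vec_eq_iff sum_UNIV_sum_type split: sum.split)

lemma transpose_block_col_mult:
  "transpose (block_col U V) ** block_col X Y = transpose U ** X + transpose V ** Y"
  by (auto simp: block_col_def transpose_def matrix_matrix_mult_def vec_eq_iff sum_UNIV_sum_type split: sum.split)

lemma block_mat_add:
  "block_mat W X Y Z + block_mat W' X' Y' Z' = block_mat (W + W') (X + X') (Y + Y') (Z + Z')"
  by (auto simp: block_mat_def vec_eq_iff split: sum.split)

lemma block_mat_eq_zero_iff: "block_mat W X Y Z = 0 \<longleftrightarrow> W = 0 \<and> X = 0 \<and> Y = 0 \<and> Z = 0"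
  by (auto simp: block_mat_def vec_eq_iff split: sum.splits)

lemma transpose_block_mat:
  "transpose (block_mat W X Y Z) = block_mat (transpose W) (transpose Y) (transpose X) (transpose Z)"
  by (auto simp: block_mat_def transpose_def vec_eq_iff split: sum.split)

subsection \<open>The power system\<close>

lemma minus_matrix_mult_vec: "(- X) *v x = - (X *v x)" for X :: "real^'n^'m"
  by (simp add: matrix_vector_mult_def vec_eq_iff sum_negf)

lemma sysA_eq_block_mat:
  assumes "\<And>i. m $ i \<noteq> 0"
  shows "sysA L d m = block_mat 0 (mat 1)
    (- (diag_mat (\<chi> i. inverse (m $ i)) ** L)) (- (diag_mat (\<chi> i. inverse (m $ i)) ** diag_mat d))"
  by (simp add: sysA_def matrix_inv_diag_mat assms)

lemma sysA_mult_vec: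
  assumes "\<And>i. m $ i \<noteq> 0"
  shows "sysA L d m *v block_vec x y
    = block_vec y (\<chi> i. - ((L *v x) $ i + d $ i * y $ i) / m $ i)"
  unfolding sysA_eq_block_mat[OF assms] block_mat_mult_vec block_vec_eq_iff
  by (simp add: minus_matrix_mult_vec matrix_vector_mul_assoc[symmetric] vec_eq_iff diag_mat_mult_vec
      assms field_simps)

lemma weighted_square_sum_pos:
  fixes x :: "real^'n"
  assumes "\<And>i. 0 < w i" "x \<noteq> 0"
  shows "0 < (\<Sum>i\<in>UNIV. w i * (x $ i)\<^sup>2)"
proof -
  obtain k where "x $ k \<noteq> 0" using assms(2) by (auto simp: vec_eq_iff)
  then show ?thesis
    using assms(1) by (intro sum_pos2[of _ k]) (simp_all add: less_imp_le)
qed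

text \<open>
  The cross term with coefficient e supplies the decay in the angles, which the energy (e = 0)
  lacks; its part e D / 2 is chosen so that the mixed terms in the derivative cancel.
\<close>

lemma sysA_lyapunov_form:
  fixes L :: "real^'n^'n" and d m x y :: "real^'n"
  defines "R \<equiv> \<lambda>e. block_mat ((1/2) *\<^sub>R (L + e *\<^sub>R diag_mat d)) (e *\<^sub>R diag_mat m) 0 ((1/2) *\<^sub>R diag_mat m)"
  assumes sym: "transpose L = L" and m: "\<And>i. m $ i \<noteq> 0"
  shows "block_vec x y \<bullet> (R e *v block_vec x y) = x \<bullet> (L *v x) / 2
      + (\<Sum>i\<in>UNIV. e * (d $ i - e * m $ i) / 2 * (x $ i)\<^sup>2)
      + (\<Sum>i\<in>UNIV. m $ i / 2 * (y $ i + e * x $ i)\<^sup>2)" (is ?form)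
    and "block_vec x y \<bullet> ((R e ** sysA L d m + transpose (sysA L d m) ** R e) *v block_vec x y)
      = - e * (x \<bullet> (L *v x)) - (\<Sum>i\<in>UNIV. (d $ i - e * m $ i) * (y $ i)\<^sup>2)" (is ?deriv)
proof -
  have R: "R e *v block_vec u v = block_vec
      (\<chi> i. ((L *v u) $ i + e * d $ i * u $ i) / 2 + e * m $ i * v $ i) (\<chi> i. m $ i * v $ i / 2)" for u v
    unfolding R_def block_mat_mult_vec block_vec_eq_iff
    by (simp add: scaleR_matrix_vector_assoc[symmetric] matrix_vector_mult_add_rdistrib vec_eq_iff
        diag_mat_mult_vec field_simps)
  have "block_vec x y \<bullet> (R e *v block_vec x y)
      = (\<Sum>i\<in>UNIV. x $ i * (((L *v x) $ i + e * d $ i * x $ i) / 2 + e * m $ i * y $ i) + y $ i * (m $ i * y $ i / 2))"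
    unfolding R block_vec_inner by (simp add: inner_vec_def sum.distrib)
  also have "\<dots> = (\<Sum>i\<in>UNIV. x $ i * (L *v x) $ i / 2 + e * (d $ i - e * m $ i) / 2 * (x $ i)\<^sup>2
      + m $ i / 2 * (y $ i + e * x $ i)\<^sup>2)"
    by (intro sum.cong refl) (simp add: power2_eq_square field_simps)
  finally show ?form
    by (simp add: sum.distrib inner_vec_def sum_divide_distrib)

  define q where "q = (\<chi> i. - ((L *v x) $ i + d $ i * y $ i) / m $ i)"
  have A: "sysA L d m *v block_vec x y = block_vec y q"
    unfolding q_def by (rule sysA_mult_vec[OF m])
  have mq: "m $ i * q $ i = - ((L *v x) $ i + d $ i * y $ i)" for i
    using m by (simp add: q_def)
  have "block_vec x y \<bullet> (transpose (sysA L d m) *v (R e *v block_vec x y))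
      = (sysA L d m *v block_vec x y) \<bullet> (R e *v block_vec x y)"
    by (metis dot_lmul_matrix vector_transpose_matrix)
  then have "block_vec x y \<bullet> ((R e ** sysA L d m + transpose (sysA L d m) ** R e) *v block_vec x y)
      = block_vec x y \<bullet> (R e *v block_vec y q) + block_vec y q \<bullet> (R e *v block_vec x y)"
    by (simp add: matrix_vector_mult_add_rdistrib inner_add_right matrix_vector_mul_assoc[symmetric] A
        del: transpose_matrix_vector)
  also have "\<dots> = (\<Sum>i\<in>UNIV.
        x $ i * (((L *v y) $ i + e * d $ i * y $ i) / 2 + e * (m $ i * q $ i)) + y $ i * (m $ i * q $ i) / 2
      + (y $ i * (((L *v x) $ i + e * d $ i * x $ i) / 2 + e * m $ i * y $ i) + (m $ i * q $ i) * y $ i / 2))"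
    unfolding R block_vec_inner by (simp add: inner_vec_def sum.distrib mult_ac sum_divide_distrib[symmetric])
  also have "\<dots> = (\<Sum>i\<in>UNIV. (x $ i * (L *v y) $ i - y $ i * (L *v x) $ i) / 2
      - e * (x $ i * (L *v x) $ i) - (d $ i - e * m $ i) * (y $ i)\<^sup>2)"
    unfolding mq by (intro sum.cong refl) (simp add: power2_eq_square field_simps)
  also have "\<dots> = (x \<bullet> (L *v y) - y \<bullet> (L *v x)) / 2 - e * (x \<bullet> (L *v x))
      - (\<Sum>i\<in>UNIV. (d $ i - e * m $ i) * (y $ i)\<^sup>2)"
    by (simp add: sum_subtractf inner_vec_def sum_divide_distrib[symmetric] sum_distrib_left[symmetric])
  also have "x \<bullet> (L *v y) = y \<bullet> (L *v x)"
    using symmetric_inner_commute[OF sym, of x y] by (simp add: inner_commute)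
  finally show ?deriv by simp
qed

lemma sysA_mult_z0:
  assumes "\<And>i. m $ i \<noteq> 0" "L *v 1 = 0"
  shows "sysA L d m *v z0 = 0"
  unfolding z0_eq_block_vec sysA_mult_vec[OF assms(1)] block_vec_eq_zero_iff
  by (simp add: assms(2) vec_eq_iff)

lemma sysA_flow_converges:
  fixes d m :: "real^'n" and b :: "'n \<Rightarrow> 'n \<Rightarrow> real"
  assumes b: "graph_weights b" "graph_connected b"
    and d: "\<And>i. 0 < d $ i" and m: "\<And>i. 0 < m $ i"
  obtains c where "((\<lambda>t. mat_exp (t *\<^sub>R sysA (laplacian b) d m) *v x) \<longlongrightarrow> c *\<^sub>R z0) at_top"
proof -
  let ?L = "laplacian b"
  let ?A = "sysA ?L d m"
  note sym = transpose_laplacian[OF b(1)]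
  have m0: "m $ i \<noteq> 0" for i using m[of i] by simp
  have Lnn: "0 \<le> u \<bullet> (?L *v u)" for u using psd_laplacian[OF b(1)] by (simp add: psd_def)
  define e where "e = Min (range (\<lambda>i. d $ i / m $ i)) / 2"
  have "0 < Min (range (\<lambda>i. d $ i / m $ i))" using d m by (subst Min_gr_iff) auto
  then have e: "0 < e" by (simp add: e_def)
  have em: "0 < d $ i - e * m $ i" for i
  proof -
    have "2 * e \<le> d $ i / m $ i" by (simp add: e_def)
    then have "e < d $ i / m $ i" using e by linarith
    then show ?thesis using m[of i] by (simp add: field_simps)
  qed
  define R where "R = block_mat ((1/2) *\<^sub>R (?L + e *\<^sub>R diag_mat d)) (e *\<^sub>R diag_mat m) 0 ((1/2) *\<^sub>R diag_mat m)"
  note form = sysA_lyapunov_form[OF sym m0, where e=e and d=d, folded R_def]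
  define h where "h = block_vec d m"
  define H where "H = {w. h \<bullet> w = 0}"
  have H: "subspace H" unfolding H_def by (rule subspace_hyperplane)
  have hA: "h \<bullet> (?A *v w) = 0" for w
  proof -
    obtain u v where w: "w = block_vec u v" by (rule block_vec_exists)
    have "h \<bullet> (?A *v w) = (\<Sum>i\<in>UNIV. d $ i * v $ i - ((?L *v u) $ i + d $ i * v $ i))"
      unfolding w h_def sysA_mult_vec[OF m0] block_vec_inner
      by (simp add: inner_vec_def sum.distrib[symmetric] m0)
    also have "\<dots> = - (1 \<bullet> (?L *v u))" by (simp add: inner_vec_def sum_negf)
    also have "\<dots> = 0" using symmetric_inner_commute[OF sym, of 1 u] by (simp add: laplacian_mult_one)
    finally show ?thesis .
  qed
  have inv: "h \<bullet> (mat_exp (t *\<^sub>R ?A) *v w) = h \<bullet> w" for t w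
    by (rule linear_invariant_flow[OF hA])
  have pos: "0 < w \<bullet> (R *v w)" if "w \<in> H" "w \<noteq> 0" for w
  proof -
    obtain u v where w: "w = block_vec u v" by (rule block_vec_exists)
    have 1: "0 \<le> (\<Sum>i\<in>UNIV. e * (d $ i - e * m $ i) / 2 * (u $ i)\<^sup>2)"
      using e em by (intro sum_nonneg mult_nonneg_nonneg) (auto intro: less_imp_le)
    have 2: "0 \<le> (\<Sum>i\<in>UNIV. m $ i / 2 * (v $ i + e * u $ i)\<^sup>2)"
      using m by (intro sum_nonneg mult_nonneg_nonneg) (auto intro: less_imp_le)
    show ?thesis
    proof (cases "u = 0")
      case True
      then have "v \<noteq> 0" using that(2) by (simp add: w block_vec_eq_zero_iff)
      then have "0 < (\<Sum>i\<in>UNIV. m $ i / 2 * (v $ i)\<^sup>2)"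
        using m by (intro weighted_square_sum_pos) auto
      then show ?thesis unfolding w form(1) using True by simp
    next
      case False
      then have "0 < (\<Sum>i\<in>UNIV. e * (d $ i - e * m $ i) / 2 * (u $ i)\<^sup>2)"
        using e em by (intro weighted_square_sum_pos) auto
      then show ?thesis unfolding w form(1) using Lnn[of u] 2 by linarith
    qed
  qed
  have neg: "w \<bullet> ((R ** ?A + transpose ?A ** R) *v w) < 0" if "w \<in> H" "w \<noteq> 0" for w
  proof -
    obtain u v where w: "w = block_vec u v" by (rule block_vec_exists)
    have nn: "0 \<le> e * (u \<bullet> (?L *v u))" using e Lnn by simp
    show ?thesis
    proof (cases "v = 0")
      case False
      then have "0 < (\<Sum>i\<in>UNIV. (d $ i - e * m $ i) * (v $ i)\<^sup>2)"
        using em by (intro weighted_square_sum_pos) auto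
      then show ?thesis unfolding w form(2) using nn by simp
    next
      case True
      have "u \<bullet> (?L *v u) \<noteq> 0"
      proof
        assume "u \<bullet> (?L *v u) = 0"
        then obtain k where const: "\<And>i. u $ i = k"
          using laplacian_form_zero_imp_const[OF b] by blast
        have "0 = d \<bullet> u" using that(1) by (simp add: H_def h_def w block_vec_inner True)
        also have "\<dots> = (\<Sum>i\<in>UNIV. d $ i) * k"
          by (simp add: inner_vec_def sum_distrib_right const)
        finally have "k = 0" using sum_pos[of UNIV "\<lambda>i. d $ i"] d by auto
        then have "u = 0" using const by (simp add: vec_eq_iff)
        then show False using that(2) True by (simp add: w block_vec_eq_zero_iff)
      qed
      then have "0 < u \<bullet> (?L *v u)" using Lnn[of u] by simp
      then show ?thesis unfolding w form(2) using e True by simp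
    qed
  qed
  have hz: "h \<bullet> z0 \<noteq> 0"
    using sum_pos[of UNIV "\<lambda>i. d $ i"] d
    unfolding h_def z0_eq_block_vec block_vec_inner by (simp add: inner_vec_def)
  define c where "c = (h \<bullet> x) / (h \<bullet> z0)"
  have "x - c *\<^sub>R z0 \<in> H"
    using hz by (simp add: H_def inner_diff_right c_def)
  then have "((\<lambda>t. mat_exp (t *\<^sub>R ?A) *v (x - c *\<^sub>R z0)) \<longlongrightarrow> 0) at_top"
    using lyapunov_asymptotic_stability[OF H _ pos neg] by (simp add: H_def inv)
  then have "((\<lambda>t. mat_exp (t *\<^sub>R ?A) *v x - c *\<^sub>R z0) \<longlongrightarrow> 0) at_top"
    by (simp add: matrix_vector_mult_diff_distrib matrix_vector_mult_scaleR mat_exp_kernel[OF sysA_mult_z0[OF m0 laplacian_mult_one]])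
  then have "((\<lambda>t. mat_exp (t *\<^sub>R ?A) *v x) \<longlongrightarrow> c *\<^sub>R z0) at_top"
    by (simp add: Lim_null[of _ "c *\<^sub>R z0"])
  then show thesis by (rule that)
qed

lemma matrix_mult_minus: "X ** (- Y) = - (X ** Y)" "(- X) ** Y = - (X ** Y)"
  for X :: "real^'n^'m" and Y :: "real^'k^'n"
  by (simp_all add: matrix_matrix_mult_def vec_eq_iff sum_negf)

lemma matrix_add_rdistrib: "(X + Y) ** Z = X ** Z + Y ** Z"
  for X Y :: "real^'n^'m" and Z :: "real^'k^'n"
  by (simp add: matrix_matrix_mult_def vec_eq_iff distrib_right sum.distrib)

lemma transpose_minus: "transpose (- X) = - transpose X" for X :: "real^'n^'m"
  by (simp add: transpose_def vec_eq_iff)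

lemma transpose_zero: "transpose 0 = (0 :: real^'n^'m)"
  by (simp add: transpose_def vec_eq_iff)

lemma matrix_mult_zero: "X ** 0 = (0 :: real^'k^'m)" "0 ** Y = (0 :: real^'k^'m)"
  for X :: "real^'n^'m" and Y :: "real^'k^'n"
  by (simp_all add: matrix_matrix_mult_def vec_eq_iff)

lemma transpose_sysC_mult_sysC:
  assumes "psd N" "\<And>i. 0 \<le> s $ i"
  shows "transpose (sysC N s) ** sysC N s = block_mat N 0 0 (diag_mat s)"
proof -
  have "transpose (mat_sqrt N) = mat_sqrt N" "transpose (mat_sqrt (diag_mat s)) = mat_sqrt (diag_mat s)"
    using mat_sqrt_psd(1) psd_diag_mat[OF assms(2)] assms(1) by (auto simp: psd_def)
  then show ?thesis
    using mat_sqrt_psd(2)[OF assms(1)] mat_sqrt_psd(2)[OF psd_diag_mat[OF assms(2)]]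
    by (simp add: sysC_def transpose_block_mat block_mat_mult transpose_zero matrix_mult_zero)
qed

lemma inertia_objective_block_mat:
  fixes v m :: "real^'n"
  assumes v: "\<And>i. 0 \<le> v $ i" and m: "\<And>i. m $ i \<noteq> 0"
  shows "inertia_objective v m (block_mat W X Y Z) = (\<Sum>i\<in>UNIV. v $ i / (m $ i)\<^sup>2 * Z $ i $ i)"
proof -
  define R where "R = mat_sqrt (diag_mat v)"
  define D where "D = diag_mat (\<chi> i. inverse (m $ i))"
  have R: "transpose R = R" "R ** R = diag_mat v"
    using mat_sqrt_psd[OF psd_diag_mat[OF v]] by (auto simp: R_def psd_def)
  have B: "sysB v m = block_col 0 (D ** R)"
    by (simp add: sysB_def R_def D_def matrix_inv_diag_mat m)
  have "inertia_objective v m (block_mat W X Y Z) = trace (transpose (D ** R) ** (Z ** (D ** R)))"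
    by (simp add: inertia_objective_def B matrix_mul_assoc[symmetric] block_mat_mult_block_col
        transpose_block_col_mult transpose_zero matrix_mult_zero)
  also have "\<dots> = trace ((Z ** (D ** R)) ** transpose (D ** R))"
    by (rule trace_mul_sym)
  also have "\<dots> = trace (Z ** (D ** (diag_mat v ** D)))"
    by (simp add: matrix_transpose_mul R(1) D_def transpose_diag_mat matrix_mul_assoc[symmetric])
      (simp add: matrix_mul_assoc[of R R] R(2))
  also have "\<dots> = (\<Sum>i\<in>UNIV. v $ i / (m $ i)\<^sup>2 * Z $ i $ i)"
    by (simp add: trace_def D_def matrix_mul_assoc mult_diag_mat_entry divide_inverse power2_eq_square mult_ac)
  finally show ?thesis .
qed

lemma laplacian_pinv_projection:
  fixes w :: "'n::finite \<Rightarrow> 'n \<Rightarrow> real" and Y :: "real^'n^'m" and X :: "real^'m^'n"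
  assumes w: "graph_weights w" "graph_connected w"
  shows "Y *v 1 = 0 \<Longrightarrow> Y ** (pinv (laplacian w) ** laplacian w) = Y"
    and "transpose X *v 1 = 0 \<Longrightarrow> (laplacian w ** pinv (laplacian w)) ** X = X"
proof -
  let ?L = "laplacian w" and ?G = "pinv (laplacian w)"
  note sym = transpose_laplacian[OF w(1)]
  note LGL = symmetric_pinv[OF sym]
  have diff: "U ** (mat 1 - Z) = U - U ** Z" for U :: "real^'n^'k" and Z :: "real^'n^'n"
    using matrix_add_ldistrib[of U "mat 1" "- Z"] by (simp add: matrix_mult_minus)
  \<comment> \<open>The columns of 1 - Z lie in the kernel of the Laplacian, so they are constant, and U annihilates them.\<close>
  have *: "U ** Z = U" if "?L ** Z = ?L" "U *v 1 = 0" for U :: "real^'n^'k" and Z :: "real^'n^'n"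
  proof -
    have "?L ** (mat 1 - Z) = 0" using that by (simp add: diff)
    from laplacian_mult_zero_imp_rows_eq[OF w this]
    have row: "(mat 1 - Z) $ i $ k = (mat 1 - Z) $ j $ k" for i j k .
    have "(U ** (mat 1 - Z)) $ i $ k = (U *v 1) $ i * (mat 1 - Z) $ undefined $ k" for i k
    proof -
      have "(U ** (mat 1 - Z)) $ i $ k = (\<Sum>j\<in>UNIV. U $ i $ j * (mat 1 - Z) $ j $ k)"
        by (simp add: matrix_matrix_mult_def)
      also have "\<dots> = (\<Sum>j\<in>UNIV. U $ i $ j * (mat 1 - Z) $ undefined $ k)"
        by (intro sum.cong refl arg_cong2[of _ _ _ _ "(*)"] row)
      also have "\<dots> = (U *v 1) $ i * (mat 1 - Z) $ undefined $ k"
        by (simp add: matrix_vector_mult_def sum_distrib_right)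
      finally show ?thesis .
    qed
    then have "U ** (mat 1 - Z) = 0" using that(2) by (simp add: vec_eq_iff)
    then show ?thesis by (simp add: diff)
  qed
  show "Y *v 1 = 0 \<Longrightarrow> Y ** (?G ** ?L) = Y"
    by (rule *) (simp_all add: matrix_mul_assoc LGL)
  assume X: "transpose X *v 1 = 0"
  have "?L ** transpose (?L ** ?G) = transpose (?L ** ?G ** ?L)"
    by (simp only: matrix_transpose_mul sym matrix_mul_assoc)
  then have "?L ** transpose (?L ** ?G) = ?L" by (simp only: LGL sym)
  from *[OF this X] have "transpose X ** transpose (?L ** ?G) = transpose X" .
  then show "(?L ** ?G) ** X = X"
    by (simp only: matrix_transpose_mul[symmetric] transpose_iff)
qed

lemma weighted_sum_ratio_bounds:
  fixes d v \<tau> :: "'n::finite \<Rightarrow> real"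
  assumes d: "\<And>i. 0 < d i" and v: "\<And>i. 0 \<le> v i" and \<tau>: "\<And>i. 0 \<le> \<tau> i"
  shows "(MIN i. v i) / (2 * (MAX i. d i)) * (\<Sum>i\<in>UNIV. \<tau> i) \<le> (\<Sum>i\<in>UNIV. v i / (2 * d i) * \<tau> i)"
    and "(\<Sum>i\<in>UNIV. v i / (2 * d i) * \<tau> i) \<le> (MAX i. v i) / (2 * (MIN i. d i)) * (\<Sum>i\<in>UNIV. \<tau> i)"
proof -
  have "0 < (MIN i. d i)" using d by (subst Min_gr_iff) auto
  moreover have "0 \<le> (MAX i. v i)" using v[of undefined] by (subst Max_ge_iff) auto
  ultimately have "v i / (2 * d i) \<le> (MAX i. v i) / (2 * (MIN i. d i))" for i
    by (intro frac_le) auto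
  then show "(\<Sum>i\<in>UNIV. v i / (2 * d i) * \<tau> i) \<le> (MAX i. v i) / (2 * (MIN i. d i)) * (\<Sum>i\<in>UNIV. \<tau> i)"
    unfolding sum_distrib_left by (intro sum_mono mult_right_mono \<tau>)
  have "(MIN i. v i) / (2 * (MAX i. d i)) \<le> v i / (2 * d i)" for i
    using d v by (intro frac_le) auto
  then show "(MIN i. v i) / (2 * (MAX i. d i)) * (\<Sum>i\<in>UNIV. \<tau> i) \<le> (\<Sum>i\<in>UNIV. v i / (2 * d i) * \<tau> i)"
    unfolding sum_distrib_left by (intro sum_mono mult_right_mono \<tau>)
qed

lemma sysA_lyapunov_solution_nonneg:
  fixes b :: "'n::finite \<Rightarrow> 'n \<Rightarrow> real" and C :: "real^('n + 'n)^'q"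
  assumes "graph_weights b" "graph_connected b" "\<And>i. 0 < d $ i" "\<And>i. 0 < m $ i"
    and lyap: "P ** sysA (laplacian b) d m + transpose (sysA (laplacian b) d m) ** P + transpose C ** C = 0"
    and z: "P *v z0 = 0"
  shows "((\<lambda>t. (mat_exp (t *\<^sub>R sysA (laplacian b) d m) *v x)
      \<bullet> (P *v (mat_exp (t *\<^sub>R sysA (laplacian b) d m) *v x))) \<longlongrightarrow> 0) at_top" (is "(?V \<longlongrightarrow> 0) at_top")
    and "0 \<le> x \<bullet> (P *v x)" and "z0 \<bullet> (P *v x) = 0"
proof -
  let ?A = "sysA (laplacian b) d m"
  have lim: "((\<lambda>t. (mat_exp (t *\<^sub>R ?A) *v x) \<bullet> (P *v (mat_exp (t *\<^sub>R ?A) *v x))) \<longlongrightarrow> 0) at_top" for x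
  proof -
    obtain c where "((\<lambda>t. mat_exp (t *\<^sub>R ?A) *v x) \<longlongrightarrow> c *\<^sub>R z0) at_top"
      using sysA_flow_converges[OF assms(1-4)] by blast
    from tendsto_inner[OF this bounded_linear.tendsto[OF matrix_vector_mul_bounded_linear[of P] this]]
    show ?thesis by (simp add: matrix_vector_mult_scaleR z)
  qed
  then show "(?V \<longlongrightarrow> 0) at_top" .
  have nonneg: "0 \<le> x \<bullet> (P *v x)" for x
    using has_integral_nonneg[OF lyapunov_output_energy[OF lyap lim]] by simp
  then show "0 \<le> x \<bullet> (P *v x)" .
  show "z0 \<bullet> (P *v x) = 0"
    using psd_form_zero[OF matrix_vector_mul_linear[of P] subspace_UNIV, of z0 x] nonneg z by simp
qed

theorem theorem2:
  fixes b a :: "'n::finite \<Rightarrow> 'n \<Rightarrow> real"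
    and L N :: "real^'n^'n"
    and d v s m mlo mhi :: "real^'n"
    and mbdg :: real
    and P :: "real^('n + 'n)^('n + 'n)"
  assumes "graph_weights b" and "graph_connected b" and "L = laplacian b"
    and "graph_weights a" and "graph_connected a" and "N = laplacian a"
    and "\<And>i. 0 < d $ i" and "\<And>i. 0 \<le> v $ i" and "\<And>i. 0 < s $ i"
    and "\<And>i. 0 < mlo $ i \<and> mlo $ i \<le> mhi $ i"
    and "inertia_feasible L d N s mlo mhi mbdg m P"
  shows "h2_integrand (sysA L d m) (sysB v m) (sysC N s) integrable_on {0..}
    \<and> h2_norm_sq (sysA L d m) (sysB v m) (sysC N s) = inertia_objective v m P
    \<and> (MIN i. v $ i) / (2 * (MAX i. d $ i)) * (trace (N ** pinv L) + (\<Sum>i\<in>UNIV. s $ i / m $ i))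
        \<le> inertia_objective v m P
    \<and> inertia_objective v m P
        \<le> (MAX i. v $ i) / (2 * (MIN i. d $ i)) * (trace (N ** pinv L) + (\<Sum>i\<in>UNIV. s $ i / m $ i))"
proof -
  note [simp] = \<open>L = laplacian b\<close> \<open>N = laplacian a\<close>
  have m: "0 < m $ i" for i
    using assms(10)[of i] assms(11) by (auto simp: inertia_feasible_def intro: less_le_trans)
  have m0: "m $ i \<noteq> 0" for i using m[of i] by simp
  have lyap: "P ** sysA (laplacian b) d m + transpose (sysA (laplacian b) d m) ** P
      + transpose (sysC N s) ** sysC N s = 0"
    and z: "P *v z0 = 0"
    using assms(11) by (auto simp: inertia_feasible_def)
  note P = sysA_lyapunov_solution_nonneg[OF assms(1,2) assms(7) m lyap z]
  have integral: "(h2_integrand (sysA L d m) (sysB v m) (sysC N s) has_integral inertia_objective v m P) {0..}"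
    unfolding inertia_objective_def using h2_integrand_has_integral[OF lyap P(1)] by simp

  obtain W X Y Z where PB: "P = block_mat W X Y Z" by (rule block_mat_exists)
  define D where "D = diag_mat (\<chi> i. inverse (m $ i))"
  have DT: "transpose D = D" by (simp add: D_def transpose_diag_mat)
  have symL: "transpose L = L" using transpose_laplacian[OF assms(1)] by simp
  have S: "0 \<le> s $ i" for i using assms(9)[of i] by simp
  have "psd N" using psd_laplacian[OF assms(4)] by simp
  note CC = transpose_sysC_mult_sysC[OF this S]
  have "block_mat W X Y Z ** block_mat 0 (mat 1) (- (D ** L)) (- (D ** diag_mat d))
      + block_mat 0 (- (L ** D)) (mat 1) (- (diag_mat d ** D)) ** block_mat W X Y Z
      + block_mat N 0 0 (diag_mat s) = 0"
    using lyap unfolding CC unfolding \<open>L = laplacian b\<close>[symmetric] sysA_eq_block_mat[OF m0] PB D_def[symmetric]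
    by (simp only: transpose_block_mat transpose_zero transpose_mat transpose_minus matrix_transpose_mul DT symL
        transpose_diag_mat)
  then have "- (X ** (D ** L)) + - (L ** D ** Y) + N = 0"
    and "Y + - (Z ** (D ** diag_mat d)) + (X + - (diag_mat d ** D ** Z)) + diag_mat s = 0"
    unfolding block_mat_mult block_mat_add block_mat_eq_zero_iff
    by (simp_all only: matrix_mult_minus matrix_mult_zero matrix_mul_lid matrix_mul_rid add_0_left)
  then have eq11: "N = X ** (D ** L) + L ** D ** Y"
    and eq22: "Y + X + diag_mat s = Z ** (D ** diag_mat d) + diag_mat d ** D ** Z"
    by (simp_all only: algebra_simps eq_neg_iff_add_eq_0)
      (simp_all add: algebra_simps eq_neg_iff_add_eq_0)
  have diag: "Y $ i $ i + X $ i $ i + s $ i = 2 * d $ i * Z $ i $ i / m $ i" for i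
  proof -
    have "Y + X + diag_mat s = Z ** D ** diag_mat d + diag_mat d ** (D ** Z)"
      using eq22 by (simp only: matrix_mul_assoc)
    from arg_cong[OF this, of "\<lambda>U. U $ i $ i"] show ?thesis
      by (simp add: D_def mult_diag_mat_entry diag_mat_mult_entry)
        (simp add: diag_mat_def divide_inverse mult_ac)
  qed

  have Y1: "Y *v 1 = 0"
    using z by (simp add: PB z0_eq_block_vec block_mat_mult_vec block_vec_eq_zero_iff)
  have "(transpose X *v 1) \<bullet> u = 0" for u
    using P(3)[of "block_vec 0 u"]
    by (simp add: PB z0_eq_block_vec block_mat_mult_vec block_vec_inner dot_lmul_matrix)
  then have X1: "transpose X *v 1 = 0" by (metis inner_eq_zero_iff)
  note proj = laplacian_pinv_projection[OF assms(1,2), folded \<open>L = laplacian b\<close>]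
  have "trace (N ** pinv L) = trace (X ** D ** (L ** pinv L)) + trace (L ** (D ** Y ** pinv L))"
    unfolding eq11 by (simp add: matrix_add_rdistrib trace_add matrix_mul_assoc)
  also have "\<dots> = trace ((L ** pinv L) ** X ** D) + trace (D ** (Y ** (pinv L ** L)))"
    unfolding trace_mul_sym[of "X ** D"] trace_mul_sym[of L] by (simp only: matrix_mul_assoc)
  also have "\<dots> = trace (X ** D) + trace (D ** Y)"
    by (simp only: proj(1)[OF Y1] proj(2)[OF X1])
  also have "\<dots> = (\<Sum>i\<in>UNIV. (Y $ i $ i + X $ i $ i) / m $ i)"
    by (simp add: trace_def D_def mult_diag_mat_entry diag_mat_mult_entry sum.distrib[symmetric]
        divide_inverse algebra_simps)
  finally have tr: "trace (N ** pinv L) + (\<Sum>i\<in>UNIV. s $ i / m $ i)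
      = (\<Sum>i\<in>UNIV. 2 * d $ i * Z $ i $ i / (m $ i)\<^sup>2)"
    by (simp add: sum.distrib[symmetric] add_divide_distrib[symmetric] diag power2_eq_square)

  have Zii: "0 \<le> Z $ i $ i" for i
  proof -
    have "Z $ i $ i = axis i 1 \<bullet> (Z *v axis i 1)"
      by (simp add: inner_axis' matrix_vector_mult_basis column_def)
    then show ?thesis
      using P(2)[of "block_vec 0 (axis i 1)"] by (simp add: PB block_mat_mult_vec block_vec_inner)
  qed
  have "inertia_objective v m P = (\<Sum>i\<in>UNIV. v $ i / (2 * d $ i) * (2 * d $ i * Z $ i $ i / (m $ i)\<^sup>2))"
  proof -
    have "d $ i \<noteq> 0" for i using assms(7)[of i] by simp
    then show ?thesis
      unfolding PB inertia_objective_block_mat[OF assms(8) m0] by (intro sum.cong refl) simp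
  qed
  moreover have "0 \<le> 2 * d $ i * Z $ i $ i / (m $ i)\<^sup>2" for i
    using Zii[of i] assms(7)[of i] by simp
  ultimately show ?thesis
    using integral weighted_sum_ratio_bounds[of "\<lambda>i. d $ i" "\<lambda>i. v $ i" "\<lambda>i. 2 * d $ i * Z $ i $ i / (m $ i)\<^sup>2"]
      assms(7,8)
    unfolding tr h2_norm_sq_def by (auto simp: has_integral_integrable_integral)
qed

end
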